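(* Let $n>3$, let $\mathfrak g$ and $V$ be $n$-Lie algebras and let $(\vartheta_V,\rho_V,\omega)$ be a sparse crossed system satisfying the crossed-product identity. Then: (i) $\rho_V$ is a representation of $V$ on $\mathfrak g$; (ii) $\omega$ is a one-cocycle for this representation, i.e. for all $u_i,v_i\in V$, $$\omega(u_1,\dots,u_{n-1},[v_1,\dots,v_n]_V)+\rho_V(u_1,\dots,u_{n-1})\omega(v_1,\dots,v_n)=\sum_{i=1}^n\omega(v_1,\dots,[u_1,\dots,u_{n-1},v_i]_V,\dots,v_n)+\sum_{i=1}^n(-1)^{n-i}\rho_V(v_1,\dots,\widehat{v_i},\dots,v_n)\omega(u_1,\dots,u_{n-1},v_i);$$ (iii) for fixed $u\in V$ and $y_2,\dots,y_{n-1}\in\mathfrak g$, the map $x\mapsto\vartheta_V(u)(x,y_2,\dots,y_{n-1})$ is a derivation of $\mathfrak g$: $$\vartheta_V(u)([x_1,\dots,x_n]_{\mathfrak g},y_2,\dots,y_{n-1})=\sum_{i=1}^n[x_1,\dots,x_{i-1},\vartheta_V(u)(x_i,y_2,\dots,y_{n-1}),x_{i+1},\dots,x_n]_{\mathfrak g};$$ (iv) for $u_1,u_2\in V$ and $x_3,\dots,x_n,y_1,\dots,y_{n-1}\in\mathfrak g$, $$0=-\vartheta_V(u_2)(\vartheta_V(u_1)(y_1,\dots,y_{n-1}),x_3,\dots,x_n)+\vartheta_V(u_1)(\vartheta_V(u_2)(y_1,\dots,y_{n-1}),x_3,\dots,x_n);$$ (v) for $u_1,\dots,u_n\in V$ and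 $y_1,\dots,y_{n-1}\in\mathfrak g$, $$[\omega(u_1,\dots,u_n),y_1,\dots,y_{n-1}]_{\mathfrak g}+\vartheta_V([u_1,\dots,u_n]_V)(y_1,\dots,y_{n-1})=\sum_{i=1}^n(-1)^{n-i}\rho_V(u_1,\dots,\widehat{u_i},\dots,u_n)\vartheta_V(u_i)(y_1,\dots,y_{n-1}),$$ and $\vartheta_V(v)(\omega(u_1,\dots,u_n),y_2,\dots,y_{n-1})=0$ for every $v\in V$ and $y_2,\dots,y_{n-1}\in\mathfrak g$.
   Context: $K$ is a field of characteristic zero; vector spaces are over $K$, all maps are linear; a hat denotes omission. An $n$-Lie algebra is a vector space with an alternating $n$-linear bracket satisfying $[z_1,\dots,z_{n-1},[w_1,\dots,w_n]]=\sum_{i=1}^n[w_1,\dots,w_{i-1},[z_1,\dots,z_{n-1},w_i],w_{i+1},\dots,w_n]$. A representation of an $n$-Lie algebra $V$ on a vector space $M$ is a linear map $\rho:\bigwedge^{n-1}V\to\mathrm{End}(M)$ with $[\rho(u_1,\dots,u_{n-1}),\rho(v_1,\dots,v_{n-1})]=\sum_{i=1}^{n-1}\rho(v_1,\dots,[u_1,\dots,u_{n-1},v_i]_V,\dots,v_{n-1})$ and $\rho(u_1,\dots,u_{n-2},[v_1,\dots,v_n]_V)=\sum_{i=1}^n(-1)^{n-i}\rho(v_1,\dots,\widehat{v_i},\dots,v_n)\rho(u_1,\dots,u_{n-2},v_i)$. A sparse crossed system consists of linear maps $\rho_V:\bigwedge^{n-1}V\to\mathrm{End}(\mathfrak g)$,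 $\vartheta_V:V\to\mathrm{Hom}(\bigwedge^{n-1}\mathfrak g,\mathfrak g)$, $\omega:\bigwedge^nV\to\mathfrak g$. Put $$\mathcal C(x_1,u_1;\dots;x_n,u_n)=[x_1,\dots,x_n]_{\mathfrak g}+\omega(u_1,\dots,u_n)+\sum_{i=1}^n(-1)^{i-1}\vartheta_V(u_i)(x_1,\dots,\widehat{x_i},\dots,x_n)+\sum_{i=1}^n(-1)^{n-i}\rho_V(u_1,\dots,\widehat{u_i},\dots,u_n)x_i.$$ The system satisfies the crossed-product identity (equivalently, $[x_1+u_1,\dots,x_n+u_n]=\mathcal C(x_1,u_1;\dots;x_n,u_n)+[u_1,\dots,u_n]_V$ is an $n$-Lie bracket on $\mathfrak g\oplus V$) if for all $x_1,\dots,x_{n-1},y_1,\dots,y_n\in\mathfrak g$, $u_1,\dots,u_{n-1},v_1,\dots,v_n\in V$ $$\mathcal C(x_1,u_1;\dots;x_{n-1},u_{n-1};\mathcal C_0,\mathcal V_0)=\sum_{i=1}^n\mathcal C(y_1,v_1;\dots;y_{i-1},v_{i-1};\mathcal C_i,\mathcal V_i;y_{i+1},v_{i+1};\dots;y_n,v_n),$$ with $\mathcal C_0=\mathcal C(y_1,v_1;\dots;y_n,v_n)$, $\mathcal V_0=[v_1,\dots,v_n]_V$, $\mathcal C_i=\mathcal C(x_1,u_1;\dots;x_{n-1},u_{n-1};y_i,v_i)$, $\mathcal V_i=[u_1,\dots,u_{n-1},v_i]_V$. *)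

theory Defs
  imports Complex_Main
begin

text \<open>
  Arguments of an \<open>n\<close>-ary map are collected in a list of length \<open>n\<close>, and a map is only ever
  constrained on lists of the right length.  List positions start at \<open>0\<close>, so the signs
  \<open>(-1)^(i-1)\<close> and \<open>(-1)^(n-i)\<close> attached to the \<open>i\<close>-th argument, \<open>1 \<le> i \<le> n\<close>, become
  \<open>(-1)^i\<close> and \<open>(-1)^(n - Suc i)\<close> for \<open>i < n\<close>.
\<close>

definition omit :: "nat \<Rightarrow> 'a list \<Rightarrow> 'a list" where
  "omit i xs = take i xs @ drop (Suc i) xs"

text \<open>
  A linear map out of the exterior power \<open>\<Lambda>\<^sup>n V\<close> is given by the corresponding alternating
  \<open>n\<close>-linear map on \<open>V\<close>.
\<close>

definition alternating_multilinear ::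
  "('k::field \<Rightarrow> 'v::ab_group_add \<Rightarrow> 'v) \<Rightarrow> ('k \<Rightarrow> 'w::ab_group_add \<Rightarrow> 'w) \<Rightarrow> nat
    \<Rightarrow> ('v list \<Rightarrow> 'w) \<Rightarrow> bool" where
  "alternating_multilinear sV sW n f \<longleftrightarrow>
    (\<forall>xs i. length xs = n \<longrightarrow> i < n \<longrightarrow> Vector_Spaces.linear sV sW (\<lambda>x. f (xs[i := x]))) \<and>
    (\<forall>xs i j. length xs = n \<longrightarrow> i < j \<longrightarrow> j < n \<longrightarrow> xs ! i = xs ! j \<longrightarrow> f xs = 0)"

locale n_lie_algebra = vector_space scale
  for scale :: "'k::field \<Rightarrow> 'v::ab_group_add \<Rightarrow> 'v" +
  fixes n :: nat
    and bracket :: "'v list \<Rightarrow> 'v"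
  assumes alternating_multilinear_bracket: "alternating_multilinear scale scale n bracket"
    and fundamental_identity:
      "\<And>zs ws. \<lbrakk>length zs = n - 1; length ws = n\<rbrakk> \<Longrightarrow>
        bracket (zs @ [bracket ws]) = (\<Sum>i<n. bracket (ws[i := bracket (zs @ [ws ! i])]))"

definition n_lie_derivation ::
  "('k::field \<Rightarrow> 'v::ab_group_add \<Rightarrow> 'v) \<Rightarrow> nat \<Rightarrow> ('v list \<Rightarrow> 'v) \<Rightarrow> ('v \<Rightarrow> 'v) \<Rightarrow> bool" where
  "n_lie_derivation scale n bracket D \<longleftrightarrow>
    Vector_Spaces.linear scale scale D \<and>
    (\<forall>xs. length xs = n \<longrightarrow> D (bracket xs) = (\<Sum>i<n. bracket (xs[i := D (xs ! i)])))"

text \<open>Linear maps \<open>\<Lambda>\<^sup>m V \<rightarrow> End(M)\<close>.\<close>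

definition alternating_End ::
  "('k::field \<Rightarrow> 'v::ab_group_add \<Rightarrow> 'v) \<Rightarrow> ('k \<Rightarrow> 'm::ab_group_add \<Rightarrow> 'm) \<Rightarrow> nat
    \<Rightarrow> ('v list \<Rightarrow> 'm \<Rightarrow> 'm) \<Rightarrow> bool" where
  "alternating_End sV sM m \<rho> \<longleftrightarrow>
    (\<forall>us. length us = m \<longrightarrow> Vector_Spaces.linear sM sM (\<rho> us)) \<and>
    (\<forall>x. alternating_multilinear sV sM m (\<lambda>us. \<rho> us x))"

text \<open>Linear maps \<open>V \<rightarrow> Hom(\<Lambda>\<^sup>m G, G)\<close>.\<close>

definition linear_Hom_alternating ::
  "('k::field \<Rightarrow> 'v::ab_group_add \<Rightarrow> 'v) \<Rightarrow> ('k \<Rightarrow> 'g::ab_group_add \<Rightarrow> 'g) \<Rightarrow> nat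
    \<Rightarrow> ('v \<Rightarrow> 'g list \<Rightarrow> 'g) \<Rightarrow> bool" where
  "linear_Hom_alternating sV sG m \<theta> \<longleftrightarrow>
    (\<forall>u. alternating_multilinear sG sG m (\<theta> u)) \<and>
    (\<forall>xs. length xs = m \<longrightarrow> Vector_Spaces.linear sV sG (\<lambda>u. \<theta> u xs))"

definition n_lie_representation ::
  "('k::field \<Rightarrow> 'v::ab_group_add \<Rightarrow> 'v) \<Rightarrow> ('k \<Rightarrow> 'm::ab_group_add \<Rightarrow> 'm) \<Rightarrow> nat
    \<Rightarrow> ('v list \<Rightarrow> 'v) \<Rightarrow> ('v list \<Rightarrow> 'm \<Rightarrow> 'm) \<Rightarrow> bool" where
  "n_lie_representation sV sM n brV \<rho> \<longleftrightarrow>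
    alternating_End sV sM (n - 1) \<rho> \<and>
    (\<forall>us vs x. length us = n - 1 \<longrightarrow> length vs = n - 1 \<longrightarrow>
      \<rho> us (\<rho> vs x) - \<rho> vs (\<rho> us x) = (\<Sum>i<n - 1. \<rho> (vs[i := brV (us @ [vs ! i])]) x)) \<and>
    (\<forall>us vs x. length us = n - 2 \<longrightarrow> length vs = n \<longrightarrow>
      \<rho> (us @ [brV vs]) x =
        (\<Sum>i<n. sM ((-1) ^ (n - Suc i)) (\<rho> (omit i vs) (\<rho> (us @ [vs ! i]) x))))"

definition one_cocycle ::
  "('k::field \<Rightarrow> 'v::ab_group_add \<Rightarrow> 'v) \<Rightarrow> ('k \<Rightarrow> 'm::ab_group_add \<Rightarrow> 'm) \<Rightarrow> nat
    \<Rightarrow> ('v list \<Rightarrow> 'v) \<Rightarrow> ('v list \<Rightarrow> 'm \<Rightarrow> 'm) \<Rightarrow> ('v list \<Rightarrow> 'm) \<Rightarrow> bool" where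
  "one_cocycle sV sM n brV \<rho> \<omega> \<longleftrightarrow>
    alternating_multilinear sV sM n \<omega> \<and>
    (\<forall>us vs. length us = n - 1 \<longrightarrow> length vs = n \<longrightarrow>
      \<omega> (us @ [brV vs]) + \<rho> us (\<omega> vs) =
        (\<Sum>i<n. \<omega> (vs[i := brV (us @ [vs ! i])])) +
        (\<Sum>i<n. sM ((-1) ^ (n - Suc i)) (\<rho> (omit i vs) (\<omega> (us @ [vs ! i])))))"

definition sparse_crossed_system ::
  "('k::field \<Rightarrow> 'g::ab_group_add \<Rightarrow> 'g) \<Rightarrow> ('k \<Rightarrow> 'v::ab_group_add \<Rightarrow> 'v) \<Rightarrow> nat
    \<Rightarrow> ('v \<Rightarrow> 'g list \<Rightarrow> 'g) \<Rightarrow> ('v list \<Rightarrow> 'g \<Rightarrow> 'g) \<Rightarrow> ('v list \<Rightarrow> 'g) \<Rightarrow> bool" where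
  "sparse_crossed_system sG sV n \<theta> \<rho> \<omega> \<longleftrightarrow>
    linear_Hom_alternating sV sG (n - 1) \<theta> \<and>
    alternating_End sV sG (n - 1) \<rho> \<and>
    alternating_multilinear sV sG n \<omega>"

text \<open>
  \<open>crossed_map sG n brG \<theta> \<rho> \<omega> [(x\<^sub>1, u\<^sub>1), \<dots>, (x\<^sub>n, u\<^sub>n)]\<close> is the \<open>G\<close>-component
  \<open>C(x\<^sub>1, u\<^sub>1; \<dots>; x\<^sub>n, u\<^sub>n)\<close> of the crossed bracket on \<open>G \<oplus> V\<close>.
\<close>

definition crossed_map ::
  "('k::field \<Rightarrow> 'g::ab_group_add \<Rightarrow> 'g) \<Rightarrow> nat \<Rightarrow> ('g list \<Rightarrow> 'g)
    \<Rightarrow> ('v \<Rightarrow> 'g list \<Rightarrow> 'g) \<Rightarrow> ('v list \<Rightarrow> 'g \<Rightarrow> 'g) \<Rightarrow> ('v list \<Rightarrow> 'g)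
    \<Rightarrow> ('g \<times> 'v) list \<Rightarrow> 'g" where
  "crossed_map sG n brG \<theta> \<rho> \<omega> ps =
    brG (map fst ps) + \<omega> (map snd ps) +
    (\<Sum>i<n. sG ((-1) ^ i) (\<theta> (snd (ps ! i)) (omit i (map fst ps)))) +
    (\<Sum>i<n. sG ((-1) ^ (n - Suc i)) (\<rho> (omit i (map snd ps)) (fst (ps ! i))))"

text \<open>
  Below \<open>ps\<close> lists the pairs \<open>(x\<^sub>j, u\<^sub>j)\<close> for \<open>1 \<le> j \<le> n - 1\<close>, and \<open>qs\<close> the pairs
  \<open>(y\<^sub>j, v\<^sub>j)\<close> for \<open>1 \<le> j \<le> n\<close>.
\<close>

definition crossed_product_identity ::
  "('k::field \<Rightarrow> 'g::ab_group_add \<Rightarrow> 'g) \<Rightarrow> nat \<Rightarrow> ('g list \<Rightarrow> 'g) \<Rightarrow> ('v list \<Rightarrow> 'v)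
    \<Rightarrow> ('v \<Rightarrow> 'g list \<Rightarrow> 'g) \<Rightarrow> ('v list \<Rightarrow> 'g \<Rightarrow> 'g) \<Rightarrow> ('v list \<Rightarrow> 'g) \<Rightarrow> bool" where
  "crossed_product_identity sG n brG brV \<theta> \<rho> \<omega> \<longleftrightarrow>
    (let C = crossed_map sG n brG \<theta> \<rho> \<omega> in
      \<forall>ps qs. length ps = n - 1 \<longrightarrow> length qs = n \<longrightarrow>
        C (ps @ [(C qs, brV (map snd qs))]) =
          (\<Sum>i<n. C (qs[i := (C (ps @ [qs ! i]), brV (map snd ps @ [snd (qs ! i)]))])))"

end

theory Submission
  imports Defs
begin

text \<open>
  The crossed map is multilinear, so it is determined by its values on lists of vectors that lie
  either in \<open>G\<close> or in \<open>V\<close>.  On such a list it depends on the number \<open>k\<close> of entries in \<open>V\<close>: it is the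
  bracket of \<open>G\<close> for \<open>k = 0\<close>, \<open>\<plusminus>\<theta>\<close> for \<open>k = 1\<close>, \<open>\<plusminus>\<rho>\<close> for \<open>k = n - 1\<close>, \<open>\<omega>\<close> for \<open>k = n\<close>, and \<open>0\<close>
  for all other \<open>k\<close>.  Since \<open>n > 3\<close>, the values \<open>2\<close> and \<open>n - 2\<close> of \<open>k\<close> are among the latter; this
  sparseness makes the crossed-product identity split into the separate claims.  Each claim is
  the identity at one choice of homogeneous arguments:

  \<^item> \<open>(us | vs, x)\<close> and \<open>(us, x | vs)\<close> give the two axioms of a representation;
  \<^item> \<open>(us | vs)\<close>, with all arguments in \<open>V\<close>, gives the cocycle condition;
  \<^item> \<open>(u, ys | xs)\<close> gives the derivation property of \<open>\<theta>\<close>;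
  \<^item> \<open>(ys | u\<^sub>1, u\<^sub>2, xs)\<close> gives the exchange relation between \<open>\<theta> u\<^sub>1\<close> and \<open>\<theta> u\<^sub>2\<close>;
  \<^item> \<open>(ys | us)\<close> and \<open>(v, ys | us)\<close> give the two compatibilities of \<open>\<theta>\<close> with \<open>\<omega>\<close>.

  A bracket of homogeneous vectors is mixed only if all of them lie in \<open>V\<close>; it then equals
  \<open>\<omega> us + [us]\<close>.  Inserted into a second bracket, its two components give values of \<open>k\<close> that
  differ by one, so that often one of them is a vanishing degree; when the other arguments are all
  in \<open>V\<close> or all in \<open>G\<close>, both survive and produce the equations that link \<open>\<omega>\<close> with \<open>\<rho>\<close> and \<open>\<theta>\<close>.
  The evaluations \<open>crossed_map_one_G\<close>, \<open>crossed_map_one_V\<close>, \<open>crossed_map_two_V\<close>,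
  \<open>crossed_map_mostly_V\<close> and \<open>crossed_map_mostly_G\<close>
  cover all these cases.  They produce the arguments of \<open>\<theta>\<close> and of the bracket with the composite
  entry last; \<open>alternating_multilinear_rotate\<close> brings it to the front.
\<close>

section \<open>Alternating multilinear maps on lists\<close>

lemma length_omit [simp]: "i < length xs \<Longrightarrow> length (omit i xs) = length xs - 1"
  by (simp add: omit_def)

lemma omit_list_update [simp]: "omit i (xs[i := x]) = omit i xs"
  by (simp add: omit_def)

lemma omit_append_Cons: "length xs = i \<Longrightarrow> omit i (xs @ x # ys) = xs @ ys"
  by (simp add: omit_def)

lemma omit_0_Cons [simp]: "omit 0 (x # xs) = xs"
  by (simp add: omit_def)

lemma nth_mem_omit:
  assumes "j < length xs" "j \<noteq> i"
  shows "xs ! j \<in> set (omit i xs)"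
proof (cases "j < i")
  case True
  then have "xs ! j \<in> set (take i xs)"
    using assms by (auto simp: in_set_conv_nth intro!: exI[of _ j])
  then show ?thesis by (simp add: omit_def)
next
  case False
  then have "xs ! j \<in> set (drop (Suc i) xs)"
    using assms by (auto simp: in_set_conv_nth intro!: exI[of _ "j - Suc i"])
  then show ?thesis by (simp add: omit_def)
qed

lemma linear_zero:
  assumes "Vector_Spaces.linear s t f"
  shows "f 0 = 0"
proof -
  interpret Vector_Spaces.linear s t f by fact
  show ?thesis by (rule zero)
qed

lemma alternating_multilinear_eq_0:
  assumes "alternating_multilinear sV sW n f" "length xs = n" "0 \<in> set xs"
  shows "f xs = 0"
proof -
  obtain i where i: "i < n" "xs ! i = 0"
    using assms by (auto simp: in_set_conv_nth)
  have "Vector_Spaces.linear sV sW (\<lambda>x. f (xs[i := x]))"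
    using assms i by (auto simp: alternating_multilinear_def)
  from linear_zero[OF this] i show ?thesis by (metis list_update_id)
qed

lemma alternating_multilinear_linear:
  assumes "alternating_multilinear sV sW n f" "Suc (length as + length bs) = n"
  shows "Vector_Spaces.linear sV sW (\<lambda>z. f (as @ z # bs))"
proof -
  have "Vector_Spaces.linear sV sW (\<lambda>z. f ((as @ 0 # bs)[length as := z]))"
  proof -
    have "length (as @ 0 # bs) = n" "length as < n" using assms(2) by auto
    then show ?thesis using assms(1) unfolding alternating_multilinear_def by blast
  qed
  then show ?thesis by simp
qed

lemma alternating_multilinear_add:
  assumes "alternating_multilinear sV sW n f" "Suc (length as + length bs) = n"
  shows "f (as @ (x + y) # bs) = f (as @ x # bs) + f (as @ y # bs)"
proof -
  interpret Vector_Spaces.linear sV sW "\<lambda>z. f (as @ z # bs)"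
    using assms by (rule alternating_multilinear_linear)
  show ?thesis by (rule add)
qed

text \<open>Polarisation of \<open>f (\<dots>, x + y, x + y, \<dots>) = 0\<close>.\<close>

lemma alternating_multilinear_swap:
  assumes f: "alternating_multilinear sV sW n f" and len: "length (as @ x # y # bs) = n"
  shows "f (as @ x # y # bs) = - f (as @ y # x # bs)"
proof -
  have diag: "f (as @ z # z # bs) = 0" for z
  proof -
    have "(as @ z # z # bs) ! length as = (as @ z # z # bs) ! Suc (length as)"
      by (simp add: nth_append)
    moreover have "length (as @ z # z # bs) = n" "length as < Suc (length as)" "Suc (length as) < n"
      using len by auto
    ultimately show ?thesis
      using f unfolding alternating_multilinear_def by blast
  qed
  have add1: "f (as @ (x + y) # z # bs) = f (as @ x # z # bs) + f (as @ y # z # bs)" for z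
    using alternating_multilinear_add[OF f, of as "z # bs" x y] len by simp
  have add2: "f (as @ z # (x + y) # bs) = f (as @ z # x # bs) + f (as @ z # y # bs)" for z
    using alternating_multilinear_add[OF f, of "as @ [z]" bs x y] len by simp
  have "f (as @ x # y # bs) + f (as @ y # x # bs) = 0"
    using diag[of "x + y"] diag[of x] diag[of y] by (simp add: add1 add2 add.commute)
  then show ?thesis by (simp add: eq_neg_iff_add_eq_0)
qed

text \<open>
  Each step of moving the last entry leftwards is a transposition; the prefix \<open>as\<close>, which grows in
  the induction, makes the statement provable by peeling entries off \<open>ys\<close>.
\<close>

lemma alternating_multilinear_rotate:
  assumes f: "alternating_multilinear sV sW n f" and W: "vector_space sW"
    and len: "length (as @ ys @ [x]) = n"
  shows "f (as @ ys @ [x]) = sW ((-1) ^ length ys) (f (as @ x # ys))"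
  using len
proof (induction ys arbitrary: as)
  case Nil
  interpret vector_space sW by (rule W)
  show ?case by simp
next
  case (Cons y ys)
  interpret vector_space sW by (rule W)
  have "f (as @ (y # ys) @ [x]) = sW ((-1) ^ length ys) (f (as @ y # x # ys))"
    using Cons.IH[of "as @ [y]"] Cons.prems by simp
  also have "f (as @ y # x # ys) = - f (as @ x # y # ys)"
    by (rule alternating_multilinear_swap[OF f]) (use Cons.prems in simp)
  finally show ?case by simp
qed

section \<open>The crossed map on homogeneous arguments\<close>

locale crossed_product =
  G: n_lie_algebra sG n brG + V: n_lie_algebra sV n brV
  for n :: nat
    and sG :: "'k::field \<Rightarrow> 'g::ab_group_add \<Rightarrow> 'g"
    and sV :: "'k \<Rightarrow> 'v::ab_group_add \<Rightarrow> 'v"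
    and brG :: "'g list \<Rightarrow> 'g" and brV :: "'v list \<Rightarrow> 'v" +
  fixes \<theta> :: "'v \<Rightarrow> 'g list \<Rightarrow> 'g"
    and \<rho> :: "'v list \<Rightarrow> 'g \<Rightarrow> 'g"
    and \<omega> :: "'v list \<Rightarrow> 'g"
  assumes n_gt_3: "n > 3"
    and sparse: "sparse_crossed_system sG sV n \<theta> \<rho> \<omega>"
    and identity: "crossed_product_identity sG n brG brV \<theta> \<rho> \<omega>"
begin

abbreviation C :: "('g \<times> 'v) list \<Rightarrow> 'g" where
  "C \<equiv> crossed_map sG n brG \<theta> \<rho> \<omega>"

abbreviation inG :: "'g \<Rightarrow> 'g \<times> 'v" where
  "inG x \<equiv> (x, 0)"

abbreviation inV :: "'v \<Rightarrow> 'g \<times> 'v" where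
  "inV u \<equiv> (0, u)"

lemma crossed_fundamental_identity:
  assumes "length ps = n - 1" "length qs = n"
  shows "C (ps @ [(C qs, brV (map snd qs))]) =
    (\<Sum>i<n. C (qs[i := (C (ps @ [qs ! i]), brV (map snd ps @ [snd (qs ! i)]))]))"
  using identity assms by (simp add: crossed_product_identity_def Let_def)

lemma alternating_maps:
  shows brG_alternating: "alternating_multilinear sG sG n brG"
    and brV_alternating: "alternating_multilinear sV sV n brV"
    and omega_alternating: "alternating_multilinear sV sG n \<omega>"
    and theta_alternating: "alternating_multilinear sG sG (n - 1) (\<theta> u)"
    and rho_alternating: "alternating_multilinear sV sG (n - 1) (\<lambda>us. \<rho> us x)"
    and rho_alternating_End: "alternating_End sV sG (n - 1) \<rho>"
  using sparse G.alternating_multilinear_bracket V.alternating_multilinear_bracket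
  by (auto simp: sparse_crossed_system_def linear_Hom_alternating_def alternating_End_def)

lemmas brG_eq_0 = alternating_multilinear_eq_0[OF brG_alternating]
  and brV_eq_0 = alternating_multilinear_eq_0[OF brV_alternating]
  and omega_eq_0 = alternating_multilinear_eq_0[OF omega_alternating]
  and theta_eq_0 = alternating_multilinear_eq_0[OF theta_alternating]
  and rho_eq_0 = alternating_multilinear_eq_0[OF rho_alternating]

lemma theta_linear: "length xs = n - 1 \<Longrightarrow> Vector_Spaces.linear sV sG (\<lambda>u. \<theta> u xs)"
  using sparse by (simp add: sparse_crossed_system_def linear_Hom_alternating_def)

lemma rho_linear: "length us = n - 1 \<Longrightarrow> Vector_Spaces.linear sG sG (\<rho> us)"
  using sparse by (simp add: sparse_crossed_system_def alternating_End_def)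

lemma theta_zero: "length xs = n - 1 \<Longrightarrow> \<theta> 0 xs = 0"
  using linear_zero[OF theta_linear] .

lemma rho_zero: "length us = n - 1 \<Longrightarrow> \<rho> us 0 = 0"
  using linear_zero[OF rho_linear] .

lemma rho_scale:
  assumes "length us = n - 1"
  shows "\<rho> us (sG c x) = sG c (\<rho> us x)"
proof -
  interpret Vector_Spaces.linear sG sG "\<rho> us" using assms by (rule rho_linear)
  show ?thesis by (rule scale)
qed

lemma theta_linear_first:
  assumes "length ys = n - 2"
  shows "Vector_Spaces.linear sG sG (\<lambda>x. \<theta> u (x # ys))"
  using alternating_multilinear_linear[OF theta_alternating, of "[]" ys u] assms n_gt_3 by simp

lemma theta_scale:
  assumes "length ys = n - 2"
  shows "\<theta> u (sG c x # ys) = sG c (\<theta> u (x # ys))"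
proof -
  interpret Vector_Spaces.linear sG sG "\<lambda>x. \<theta> u (x # ys)"
    using assms by (rule theta_linear_first)
  show ?thesis by (rule scale)
qed

text \<open>
  A position without \<open>G\<close>-component must be the one that \<open>\<theta>\<close> takes from \<open>V\<close>, and dually for \<open>\<rho>\<close>;
  so each of the two sums in the crossed map has at most one nonzero term there.
\<close>

lemma theta_sum_collapse:
  assumes len: "length ps = n" and a: "a < n" "fst (ps ! a) = 0"
  shows "(\<Sum>i<n. sG ((-1) ^ i) (\<theta> (snd (ps ! i)) (omit i (map fst ps)))) =
    sG ((-1) ^ a) (\<theta> (snd (ps ! a)) (omit a (map fst ps)))"
proof -
  have "\<theta> (snd (ps ! i)) (omit i (map fst ps)) = 0" if "i < n" "i \<noteq> a" for i
    using nth_mem_omit[of a "map fst ps" i] that len a by (auto intro!: theta_eq_0)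
  then show ?thesis
    using a by (simp add: sum.remove[of "{..<n}" a])
qed

lemma rho_sum_collapse:
  assumes len: "length ps = n" and a: "a < n" "snd (ps ! a) = 0"
  shows "(\<Sum>i<n. sG ((-1) ^ (n - Suc i)) (\<rho> (omit i (map snd ps)) (fst (ps ! i)))) =
    sG ((-1) ^ (n - Suc a)) (\<rho> (omit a (map snd ps)) (fst (ps ! a)))"
proof -
  have "\<rho> (omit i (map snd ps)) (fst (ps ! i)) = 0" if "i < n" "i \<noteq> a" for i
    using nth_mem_omit[of a "map snd ps" i] that len a by (auto intro!: rho_eq_0)
  then show ?thesis
    using a by (simp add: sum.remove[of "{..<n}" a])
qed

text \<open>
  The full strength of \<open>n > 3\<close>: a zero at each of two distinct positions kills one of the sums in
  the crossed map, and up to two positions have to be left unconstrained.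
\<close>

lemma two_further_positions:
  obtains j k where "j < n" "k < n" "j \<noteq> k" "j \<noteq> a" "j \<noteq> b" "k \<noteq> a" "k \<noteq> b"
proof -
  have "card {a, b} \<le> 2" by (simp add: card_insert_if)
  then have "2 \<le> card ({..<n} - {a, b})"
    using diff_card_le_card_Diff[of "{a, b}" "{..<n}"] n_gt_3 by simp
  then obtain T where "T \<subseteq> {..<n} - {a, b}" "card T = 2"
    by (metis obtain_subset_with_card_n)
  then show ?thesis using that by (auto simp: card_2_iff)
qed

lemma theta_sum_eq_0:
  assumes "length ps = n" "\<And>j. j < n \<Longrightarrow> j \<noteq> a \<Longrightarrow> j \<noteq> b \<Longrightarrow> fst (ps ! j) = 0"
  shows "(\<Sum>i<n. sG ((-1) ^ i) (\<theta> (snd (ps ! i)) (omit i (map fst ps)))) = 0"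
proof -
  obtain j k where jk: "j < n" "k < n" "j \<noteq> k" "j \<noteq> a" "j \<noteq> b" "k \<noteq> a" "k \<noteq> b"
    by (rule two_further_positions)
  then have "\<theta> (snd (ps ! j)) (omit j (map fst ps)) = 0"
    using nth_mem_omit[of k "map fst ps" j] assms by (auto intro!: theta_eq_0)
  then show ?thesis using theta_sum_collapse[of ps j] jk assms by simp
qed

lemma rho_sum_eq_0:
  assumes "length ps = n" "\<And>j. j < n \<Longrightarrow> j \<noteq> a \<Longrightarrow> j \<noteq> b \<Longrightarrow> snd (ps ! j) = 0"
  shows "(\<Sum>i<n. sG ((-1) ^ (n - Suc i)) (\<rho> (omit i (map snd ps)) (fst (ps ! i)))) = 0"
proof -
  obtain j k where jk: "j < n" "k < n" "j \<noteq> k" "j \<noteq> a" "j \<noteq> b" "k \<noteq> a" "k \<noteq> b"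
    by (rule two_further_positions)
  then have "\<rho> (omit j (map snd ps)) (fst (ps ! j)) = 0"
    using nth_mem_omit[of k "map snd ps" j] assms by (auto intro!: rho_eq_0)
  then show ?thesis using rho_sum_collapse[of ps j] jk assms by simp
qed

lemma brG_part_eq_0:
  assumes "length ps = n" "j < n" "fst (ps ! j) = 0"
  shows "brG (map fst ps) = 0"
  using assms brG_eq_0[of "map fst ps"] nth_mem[of j "map fst ps"] by simp

lemma omega_part_eq_0:
  assumes "length ps = n" "j < n" "snd (ps ! j) = 0"
  shows "\<omega> (map snd ps) = 0"
  using assms omega_eq_0[of "map snd ps"] nth_mem[of j "map snd ps"] by simp

text \<open>
  The entries away from \<open>a\<close> and \<open>b\<close> are in \<open>V\<close> and the one at \<open>a\<close> is in \<open>G\<close>.  The entry at \<open>b\<close> may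
  be mixed: its \<open>G\<close>-component contributes a term with \<open>n - 2\<close> entries in \<open>V\<close>, which vanishes.
\<close>

lemma crossed_map_one_G:
  assumes "length ps = n" "a < n" "snd (ps ! a) = 0"
    and "\<And>j. j < n \<Longrightarrow> j \<noteq> a \<Longrightarrow> j \<noteq> b \<Longrightarrow> fst (ps ! j) = 0"
  shows "C ps = sG ((-1) ^ (n - Suc a)) (\<rho> (omit a (map snd ps)) (fst (ps ! a)))"
proof -
  obtain j where j: "j < n" "j \<noteq> a" "j \<noteq> b" using two_further_positions by metis
  show ?thesis
    unfolding crossed_map_def
    using assms j brG_part_eq_0[of ps j] omega_part_eq_0[of ps a] theta_sum_eq_0[of ps a b]
      rho_sum_collapse[of ps a] by simp
qed

text \<open>
  The dual situation: the \<open>V\<close>-component of a mixed entry at \<open>b\<close> contributes a term with two entries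
  in \<open>V\<close>, which vanishes.
\<close>

lemma crossed_map_one_V:
  assumes "length ps = n" "a < n" "fst (ps ! a) = 0"
    and "\<And>j. j < n \<Longrightarrow> j \<noteq> a \<Longrightarrow> j \<noteq> b \<Longrightarrow> snd (ps ! j) = 0"
  shows "C ps = sG ((-1) ^ a) (\<theta> (snd (ps ! a)) (omit a (map fst ps)))"
proof -
  obtain j where j: "j < n" "j \<noteq> a" "j \<noteq> b" using two_further_positions by metis
  show ?thesis
    unfolding crossed_map_def
    using assms j brG_part_eq_0[of ps a] omega_part_eq_0[of ps j] rho_sum_eq_0[of ps a b]
      theta_sum_collapse[of ps a] by simp
qed

text \<open>
  With two entries in \<open>V\<close>, whichever one \<open>\<theta>\<close> takes, the other leaves a zero among its arguments
  from \<open>G\<close>.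
\<close>

lemma crossed_map_two_V:
  assumes "length ps = n" "a < n" "b < n" "a \<noteq> b" "fst (ps ! a) = 0" "fst (ps ! b) = 0"
    and "\<And>j. j < n \<Longrightarrow> j \<noteq> a \<Longrightarrow> j \<noteq> b \<Longrightarrow> snd (ps ! j) = 0"
  shows "C ps = 0"
proof -
  have "\<theta> (snd (ps ! a)) (omit a (map fst ps)) = 0"
    using nth_mem_omit[of b "map fst ps" a] assms by (auto intro!: theta_eq_0)
  then show ?thesis using crossed_map_one_V[of ps a b] assms by simp
qed

text \<open>
  With a mixed entry at \<open>a\<close> among entries from \<open>V\<close>, both the term with \<open>n\<close> and the one with \<open>n - 1\<close>
  entries in \<open>V\<close> survive.
\<close>

lemma crossed_map_mostly_V:
  assumes "length ps = n" "a < n" and "\<And>j. j < n \<Longrightarrow> j \<noteq> a \<Longrightarrow> fst (ps ! j) = 0"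
  shows "C ps = \<omega> (map snd ps) +
    sG ((-1) ^ (n - Suc a)) (\<rho> (omit a (map snd ps)) (fst (ps ! a)))"
proof -
  have "\<rho> (omit i (map snd ps)) (fst (ps ! i)) = 0" if "i < n" "i \<noteq> a" for i
    using assms that by (simp add: rho_zero)
  then have "(\<Sum>i<n. sG ((-1) ^ (n - Suc i)) (\<rho> (omit i (map snd ps)) (fst (ps ! i)))) =
    sG ((-1) ^ (n - Suc a)) (\<rho> (omit a (map snd ps)) (fst (ps ! a)))"
    using assms(2) by (simp add: sum.remove[of "{..<n}" a])
  moreover obtain j where j: "j < n" "j \<noteq> a" using two_further_positions by metis
  ultimately show ?thesis
    unfolding crossed_map_def
    using assms brG_part_eq_0[of ps j] theta_sum_eq_0[of ps a a] by simp
qed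

lemma crossed_map_mostly_G:
  assumes "length ps = n" "a < n" and "\<And>j. j < n \<Longrightarrow> j \<noteq> a \<Longrightarrow> snd (ps ! j) = 0"
  shows "C ps = brG (map fst ps) +
    sG ((-1) ^ a) (\<theta> (snd (ps ! a)) (omit a (map fst ps)))"
proof -
  have "\<theta> (snd (ps ! i)) (omit i (map fst ps)) = 0" if "i < n" "i \<noteq> a" for i
    using assms that by (simp add: theta_zero)
  then have "(\<Sum>i<n. sG ((-1) ^ i) (\<theta> (snd (ps ! i)) (omit i (map fst ps)))) =
    sG ((-1) ^ a) (\<theta> (snd (ps ! a)) (omit a (map fst ps)))"
    using assms(2) by (simp add: sum.remove[of "{..<n}" a])
  moreover obtain j where j: "j < n" "j \<noteq> a" using two_further_positions by metis
  ultimately show ?thesis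
    unfolding crossed_map_def
    using assms omega_part_eq_0[of ps j] rho_sum_eq_0[of ps a a] by simp
qed

lemma crossed_map_V:
  assumes "length us = n"
  shows "C (map inV us) = \<omega> us"
  using crossed_map_mostly_V[of "map inV us" 0] assms n_gt_3
  by (simp add: comp_def rho_zero)

lemma crossed_map_G:
  assumes "length xs = n"
  shows "C (map inG xs) = brG xs"
  using crossed_map_mostly_G[of "map inG xs" 0] assms n_gt_3
  by (simp add: comp_def theta_zero)

lemma crossed_map_V_update:
  assumes "length vs = n" "i < n"
  shows "C ((map inV vs)[i := (x, v)]) =
    \<omega> (vs[i := v]) + sG ((-1) ^ (n - Suc i)) (\<rho> (omit i vs) x)"
  using crossed_map_mostly_V[of "(map inV vs)[i := (x, v)]" i] assms
  by (simp add: comp_def map_update)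

lemma crossed_map_V_G:
  assumes "length us = n - 1"
  shows "C (map inV us @ [inG x]) = \<rho> us x"
  using assms n_gt_3
  by (subst crossed_map_one_G[where a = "n - 1" and b = "n - 1"])
    (auto simp: comp_def nth_append omit_append_Cons)

lemma crossed_map_G_V:
  assumes "length ys = n - 1"
  shows "C (map inG ys @ [inV u]) = sG ((-1) ^ (n - 1)) (\<theta> u ys)"
  using assms n_gt_3
  by (subst crossed_map_one_V[where a = "n - 1" and b = "n - 1"])
    (auto simp: comp_def nth_append omit_append_Cons)

section \<open>The homogeneous components of the crossed-product identity\<close>

text \<open>
  The bracket of \<open>us\<close> acts as a derivation on that of \<open>vs, x\<close>: replacing \<open>x\<close> gives the second
  composite of the commutator, replacing \<open>v\<^sub>i\<close> gives the terms of the sum.  There the \<open>\<omega>\<close>-part of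
  the bracket of \<open>us, v\<^sub>i\<close> meets only \<open>n - 2\<close> entries of \<open>V\<close> and disappears.
\<close>

lemma rho_commutator:
  assumes us: "length us = n - 1" and vs: "length vs = n - 1"
  shows "\<rho> us (\<rho> vs x) - \<rho> vs (\<rho> us x) = (\<Sum>i<n - 1. \<rho> (vs[i := brV (us @ [vs ! i])]) x)"
proof -
  let ?qs = "map inV vs @ [inG x]"
  have n: "n = Suc (n - 1)" using n_gt_3 by simp
  have len: "length (us @ [v]) = n" "length (vs @ [v]) = n" for v using us vs n by simp_all
  have brV_0: "brV (us @ [0]) = 0" "brV (vs @ [0]) = 0" using len by (auto intro: brV_eq_0)
  have lhs: "C (map inV us @ [(C ?qs, brV (map snd ?qs))]) = \<rho> us (\<rho> vs x)"
    using us vs brV_0 by (simp add: crossed_map_V_G comp_def)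
  have inner: "C ((map inV vs)[i := (y, v)] @ [inG x]) = \<rho> (vs[i := v]) x" if "i < n - 1" for i y v
    using that vs n
    by (subst crossed_map_one_G[where a = "n - 1" and b = i])
      (auto simp: comp_def nth_append omit_append_Cons map_update)
  have "\<rho> us (\<rho> vs x) =
      (\<Sum>i<Suc (n - 1). C (?qs[i := (C (map inV us @ [?qs ! i]),
        brV (map snd (map inV us) @ [snd (?qs ! i)]))]))"
    using crossed_fundamental_identity[of "map inV us" ?qs] lhs us vs n by simp
  also have "\<dots> = (\<Sum>i<n - 1. \<rho> (vs[i := brV (us @ [vs ! i])]) x) + \<rho> vs (\<rho> us x)"
    using us vs inner brV_0
    by (simp add: nth_append list_update_append comp_def crossed_map_V_G)
  finally show ?thesis by simp
qed

text \<open>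
  Here \<open>x\<close> is put among the arguments that act.  They send \<open>v\<^sub>i\<close> to \<open>- \<rho> (us, v\<^sub>i) x\<close>, which lies in
  \<open>G\<close> and is then acted on by the remaining \<open>v\<^sub>j\<close>; the \<open>\<omega>\<close>-part of the bracket of \<open>vs\<close> meets only
  \<open>n - 2\<close> entries of \<open>V\<close> and disappears.
\<close>

lemma rho_brV:
  assumes us: "length us = n - 2" and vs: "length vs = n"
  shows "\<rho> (us @ [brV vs]) x =
    (\<Sum>i<n. sG ((-1) ^ (n - Suc i)) (\<rho> (omit i vs) (\<rho> (us @ [vs ! i]) x)))"
proof -
  let ?ps = "map inV us @ [inG x]"
  have n: "n = Suc (Suc (n - 2))" using n_gt_3 by simp
  \<comment> \<open>The entry from \<open>G\<close> is the last but one, whence the sign.\<close>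
  have C_ps: "C (?ps @ [(y, v)]) = - \<rho> (us @ [v]) x" for y v
    using us n
    by (subst crossed_map_one_G[where a = "n - 2" and b = "n - 1"])
      (auto simp: comp_def nth_append omit_append_Cons nth_Cons split: nat.split)
  have "brV (us @ [0, vs ! i]) = 0" for i
    using us n by (auto intro!: brV_eq_0)
  then have terms: "C ((map inV vs)[i := (C (?ps @ [map inV vs ! i]),
      brV (map snd ?ps @ [snd (map inV vs ! i)]))]) =
      - sG ((-1) ^ (n - Suc i)) (\<rho> (omit i vs) (\<rho> (us @ [vs ! i]) x))" if "i < n" for i
    using that vs C_ps rho_scale[of "omit i vs" "-1"] omega_eq_0[of "vs[i := 0]"]
    by (simp add: comp_def crossed_map_V_update set_update_memI)
  have "- \<rho> (us @ [brV vs]) x = C (?ps @ [(C (map inV vs), brV (map snd (map inV vs)))])"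
    by (simp only: C_ps) (simp add: comp_def)
  also have "\<dots> = (\<Sum>i<n. - sG ((-1) ^ (n - Suc i)) (\<rho> (omit i vs) (\<rho> (us @ [vs ! i]) x)))"
    using us vs n terms by (subst crossed_fundamental_identity) auto
  finally show ?thesis by (simp add: sum_negf)
qed

text \<open>
  The \<open>G\<close>-component of the fundamental identity for vectors of \<open>V\<close>, read off with
  \<open>crossed_map_mostly_V\<close> on both sides.
\<close>

lemma omega_cocycle:
  assumes us: "length us = n - 1" and vs: "length vs = n"
  shows "\<omega> (us @ [brV vs]) + \<rho> us (\<omega> vs) =
    (\<Sum>i<n. \<omega> (vs[i := brV (us @ [vs ! i])])) +
    (\<Sum>i<n. sG ((-1) ^ (n - Suc i)) (\<rho> (omit i vs) (\<omega> (us @ [vs ! i]))))"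
proof -
  have n: "n = Suc (n - 1)" using n_gt_3 by simp
  have C_us: "C (map inV us @ [(y, v)]) = \<omega> (us @ [v]) + \<rho> us y" for y v
    using us n
    by (subst crossed_map_mostly_V[where a = "n - 1"])
      (auto simp: comp_def nth_append omit_append_Cons)
  show ?thesis
    using crossed_fundamental_identity[of "map inV us" "map inV vs"] us vs
    by (simp add: comp_def C_us crossed_map_V crossed_map_V_update rho_zero sum.distrib)
qed

text \<open>
  The arguments \<open>u, ys\<close> act on \<open>G\<close> by \<open>\<plusminus>\<theta> u\<close>, with the same sign on both sides of the fundamental
  identity, which therefore cancels.
\<close>

lemma theta_derivation:
  assumes ys: "length ys = n - 2" and xs: "length xs = n"
  shows "\<theta> u (brG xs # ys) = (\<Sum>i<n. brG (xs[i := \<theta> u (xs ! i # ys)]))"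
proof -
  let ?ps = "inV u # map inG ys" and ?c = "(-1) ^ (n - 2) :: 'k"
  have n: "n = Suc (Suc (n - 2))" using n_gt_3 by simp
  have rotate: "\<theta> u (ys @ [z]) = sG ?c (\<theta> u (z # ys))" for z
    using alternating_multilinear_rotate[OF theta_alternating G.vector_space_axioms,
        of "[]" ys z] ys n by simp
  have C_ps: "C (?ps @ [inG z]) = sG ?c (\<theta> u (z # ys))" for z
    using ys n
    by (subst crossed_map_one_V[where a = 0 and b = 0])
      (auto simp: comp_def nth_append nth_Cons rotate split: nat.split)
  have "brV (u # map snd (map inG ys) @ [0]) = 0"
    using ys n by (auto intro!: brV_eq_0)
  then have brV_ps: "brV (map snd ?ps @ [snd (inG z)]) = 0" for z by simp
  have "brV (map snd (map inG xs)) = 0"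
    using xs n by (cases xs) (auto intro!: brV_eq_0)
  then have "sG ?c (\<theta> u (brG xs # ys)) =
      C (?ps @ [(C (map inG xs), brV (map snd (map inG xs)))])"
    using xs C_ps by (simp add: crossed_map_G)
  also have "\<dots> = (\<Sum>i<n. C ((map inG xs)[i := (C (?ps @ [map inG xs ! i]),
      brV (map snd ?ps @ [snd (map inG xs ! i)]))]))"
    using xs ys n by (intro crossed_fundamental_identity) auto
  also have "\<dots> = (\<Sum>i<n. sG ?c (brG (xs[i := \<theta> u (xs ! i # ys)])))"
  proof (intro sum.cong refl)
    fix i assume "i \<in> {..<n}"
    then have i: "i < n" by simp
    have "Vector_Spaces.linear sG sG (\<lambda>z. brG (xs[i := z]))"
      using G.alternating_multilinear_bracket xs i by (auto simp: alternating_multilinear_def)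
    then interpret L: Vector_Spaces.linear sG sG "\<lambda>z. brG (xs[i := z])" .
    have "C ((map inG xs)[i := inG (sG ?c (\<theta> u (xs ! i # ys)))]) =
        sG ?c (brG (xs[i := \<theta> u (xs ! i # ys)]))"
      using crossed_map_G[of "xs[i := sG ?c (\<theta> u (xs ! i # ys))]"] xs
      by (simp add: map_update L.scale)
    then show "C ((map inG xs)[i := (C (?ps @ [map inG xs ! i]),
        brV (map snd ?ps @ [snd (map inG xs ! i)]))]) =
        sG ?c (brG (xs[i := \<theta> u (xs ! i # ys)]))"
      using C_ps[of "xs ! i"] brV_ps[of "xs ! i"] xs i by simp
  qed
  finally show ?thesis
    by (simp flip: G.scale_sum_right)
qed

text \<open>
  The bracket of \<open>u\<^sub>1, u\<^sub>2, xs\<close> vanishes, having two entries in \<open>V\<close>.  Acting on it with \<open>ys\<close>, only the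
  terms that turn \<open>u\<^sub>1\<close> or \<open>u\<^sub>2\<close> into an element of \<open>G\<close> survive; they differ in sign because the
  remaining entry from \<open>V\<close> is second in one of them and first in the other.
\<close>

lemma theta_exchange:
  assumes xs: "length xs = n - 2" and ys: "length ys = n - 1"
  shows "\<theta> u\<^sub>1 (\<theta> u\<^sub>2 ys # xs) = \<theta> u\<^sub>2 (\<theta> u\<^sub>1 ys # xs)"
proof -
  let ?ps = "map inG ys" and ?qs = "inV u\<^sub>1 # inV u\<^sub>2 # map inG xs"
    and ?c = "(-1) ^ (n - 1) :: 'k"
  let ?term = "\<lambda>i. C (?qs[i := (C (?ps @ [?qs ! i]), brV (map snd ?ps @ [snd (?qs ! i)]))])"
  have n: "n = Suc (Suc (n - 2))" "n - 1 = Suc (n - 2)" using n_gt_3 by simp_all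
  have brV_ps: "brV (map snd ?ps @ [v]) = 0" for v
    using ys n by (cases ys) (auto intro!: brV_eq_0)
  have brV_qs: "brV (map snd ?qs) = 0"
    using xs n_gt_3 n by (cases xs) (auto intro!: brV_eq_0)
  have two_V: "C (inV u\<^sub>1 # inV u\<^sub>2 # map inG zs) = 0" if "length zs = n - 2" for zs
    using that n
    by (intro crossed_map_two_V[where a = 0 and b = 1]) (auto simp: nth_Cons split: nat.split)
  have lhs: "C (?ps @ [(C ?qs, brV (map snd ?qs))]) = 0"
    using xs ys n by (simp only: two_V brV_qs) (simp add: crossed_map_G_V theta_zero)
  have term_0: "?term 0 = - sG ?c (\<theta> u\<^sub>2 (\<theta> u\<^sub>1 ys # xs))"
  proof -
    have "C (inG (sG ?c (\<theta> u\<^sub>1 ys)) # inV u\<^sub>2 # map inG xs) =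
        - sG ?c (\<theta> u\<^sub>2 (\<theta> u\<^sub>1 ys # xs))"
      using xs n(1)
      by (subst crossed_map_one_V[where a = 1 and b = 1])
        (auto simp: nth_Cons comp_def theta_scale omit_def split: nat.split)
    then show ?thesis using ys brV_ps by (simp add: crossed_map_G_V)
  qed
  have term_1: "?term 1 = sG ?c (\<theta> u\<^sub>1 (\<theta> u\<^sub>2 ys # xs))"
  proof -
    have "C (inV u\<^sub>1 # inG (sG ?c (\<theta> u\<^sub>2 ys)) # map inG xs) = sG ?c (\<theta> u\<^sub>1 (\<theta> u\<^sub>2 ys # xs))"
      using xs n(1)
      by (subst crossed_map_one_V[where a = 0 and b = 0])
        (auto simp: nth_Cons comp_def theta_scale split: nat.split)
    then show ?thesis using ys brV_ps by (simp add: crossed_map_G_V)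
  qed
  have term_ge_2: "?term (Suc (Suc i)) = 0" if "i < n - 2" for i
    using that xs brV_ps two_V[of "xs[i := z]" for z] by (simp add: map_update)
  have "0 = (\<Sum>i<n. ?term i)"
    using crossed_fundamental_identity[of ?ps ?qs] lhs xs ys n by simp
  also have "\<dots> = ?term 0 + (?term 1 + (\<Sum>i<n - 2. ?term (Suc (Suc i))))"
    by (subst n(1)) (simp only: sum.lessThan_Suc_shift One_nat_def)
  also have "(\<Sum>i<n - 2. ?term (Suc (Suc i))) = 0"
    by (rule sum.neutral) (use term_ge_2 in blast)
  finally have "sG ?c (\<theta> u\<^sub>1 (\<theta> u\<^sub>2 ys # xs)) = sG ?c (\<theta> u\<^sub>2 (\<theta> u\<^sub>1 ys # xs))"
    unfolding term_0 term_1 by (simp add: algebra_simps)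
  then show ?thesis by simp
qed

text \<open>
  The arguments \<open>ys\<close> act on the bracket of \<open>us\<close>, which is \<open>\<omega> us + [us]\<close>; they act by the bracket of
  \<open>G\<close> on the first part and by \<open>\<theta>\<close> on the second, and send each \<open>u\<^sub>i\<close> to \<open>\<plusminus>\<theta> u\<^sub>i\<close> of \<open>ys\<close>.
\<close>

lemma brG_omega_theta_brV:
  assumes us: "length us = n" and ys: "length ys = n - 1"
  shows "brG (\<omega> us # ys) + \<theta> (brV us) ys =
    (\<Sum>i<n. sG ((-1) ^ (n - Suc i)) (\<rho> (omit i us) (\<theta> (us ! i) ys)))"
proof -
  let ?ps = "map inG ys" and ?c = "(-1) ^ (n - 1) :: 'k"
  have n: "n = Suc (n - 1)" "0 < n - 1" using n_gt_3 by simp_all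
  have rotate: "brG (ys @ [z]) = sG ?c (brG (z # ys))" for z
    using alternating_multilinear_rotate[OF brG_alternating G.vector_space_axioms,
        of "[]" ys z] ys n by simp
  have C_ps: "C (?ps @ [(z, v)]) = sG ?c (brG (z # ys) + \<theta> v ys)" for z v
    using ys n
    by (subst crossed_map_mostly_G[where a = "n - 1"])
      (auto simp: comp_def nth_append omit_append_Cons rotate G.scale_right_distrib)
  have brV_ps: "brV (map snd ?ps @ [v]) = 0" for v
    using ys n by (cases ys) (auto intro!: brV_eq_0)
  have terms: "C ((map inV us)[i := (C (?ps @ [map inV us ! i]),
      brV (map snd ?ps @ [snd (map inV us ! i)]))]) =
      sG ?c (sG ((-1) ^ (n - Suc i)) (\<rho> (omit i us) (\<theta> (us ! i) ys)))" if "i < n" for i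
    using that us ys brV_ps omega_eq_0[of "us[i := 0]"]
    by (simp add: crossed_map_V_update set_update_memI crossed_map_G_V rho_scale mult.commute)
  have "sG ?c (brG (\<omega> us # ys) + \<theta> (brV us) ys) =
      C (?ps @ [(C (map inV us), brV (map snd (map inV us)))])"
    using us by (simp add: C_ps crossed_map_V comp_def)
  also have "\<dots> = (\<Sum>i<n. sG ?c (sG ((-1) ^ (n - Suc i)) (\<rho> (omit i us) (\<theta> (us ! i) ys))))"
    using us ys terms by (subst crossed_fundamental_identity) auto
  finally show ?thesis by (simp only: flip: G.scale_sum_right) simp
qed

text \<open>
  The arguments \<open>v, ys\<close> send every element of \<open>V\<close> to a bracket with two entries in \<open>V\<close>, hence to
  \<open>0\<close>; on the \<open>\<omega>\<close>-part of the bracket of \<open>us\<close> they act by \<open>\<plusminus>\<theta> v\<close>.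
\<close>

lemma theta_omega_eq_0:
  assumes us: "length us = n" and ys: "length ys = n - 2"
  shows "\<theta> v (\<omega> us # ys) = 0"
proof -
  let ?ps = "inV v # map inG ys" and ?c = "(-1) ^ (n - 2) :: 'k"
  have n: "n = Suc (Suc (n - 2))" using n_gt_3 by simp
  have rotate: "\<theta> v (ys @ [z]) = sG ?c (\<theta> v (z # ys))" for z
    using alternating_multilinear_rotate[OF theta_alternating G.vector_space_axioms,
        of "[]" ys z] ys n by simp
  have C_ps: "C (?ps @ [(z, w)]) = sG ?c (\<theta> v (z # ys))" for z w
    using ys n
    by (subst crossed_map_one_V[where a = 0 and b = "n - 1"])
      (auto simp: comp_def nth_append nth_Cons rotate split: nat.split)
  have C_0: "C (?ps @ [inV w]) = 0" for w
    using ys n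
    by (intro crossed_map_two_V[where a = 0 and b = "n - 1"])
      (auto simp: nth_append nth_Cons split: nat.split)
  have brV_0: "brV (map snd ?ps @ [w]) = 0" for w
    using ys n n_gt_3 by (cases ys) (auto intro!: brV_eq_0)
  have terms: "C ((map inV us)[i := (C (?ps @ [map inV us ! i]),
      brV (map snd ?ps @ [snd (map inV us ! i)]))]) = 0" if "i < n" for i
    using that us C_0[of "us ! i"] brV_0[of "us ! i"] omega_eq_0[of "us[i := 0]"]
    by (simp add: crossed_map_V_update set_update_memI rho_zero)
  have "sG ?c (\<theta> v (\<omega> us # ys)) =
      C (?ps @ [(C (map inV us), brV (map snd (map inV us)))])"
    using us by (simp only: C_ps crossed_map_V)
  also have "\<dots> = 0"
    using us ys n terms by (subst crossed_fundamental_identity) auto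
  finally show ?thesis by simp
qed

end

theorem proposition5p3:
  fixes n :: nat
    and sG :: "'k::field_char_0 \<Rightarrow> 'g::ab_group_add \<Rightarrow> 'g"
    and sV :: "'k \<Rightarrow> 'v::ab_group_add \<Rightarrow> 'v"
    and brG :: "'g list \<Rightarrow> 'g" and brV :: "'v list \<Rightarrow> 'v"
    and \<theta> :: "'v \<Rightarrow> 'g list \<Rightarrow> 'g"
    and \<rho> :: "'v list \<Rightarrow> 'g \<Rightarrow> 'g"
    and \<omega> :: "'v list \<Rightarrow> 'g"
  assumes "n > 3"
    and "n_lie_algebra sG n brG"
    and "n_lie_algebra sV n brV"
    and "sparse_crossed_system sG sV n \<theta> \<rho> \<omega>"
    and "crossed_product_identity sG n brG brV \<theta> \<rho> \<omega>"
  shows "n_lie_representation sV sG n brV \<rho> \<and>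
    one_cocycle sV sG n brV \<rho> \<omega> \<and>
    (\<forall>u ys. length ys = n - 2 \<longrightarrow> n_lie_derivation sG n brG (\<lambda>x. \<theta> u (x # ys))) \<and>
    (\<forall>u\<^sub>1 u\<^sub>2 xs ys. length xs = n - 2 \<longrightarrow> length ys = n - 1 \<longrightarrow>
      0 = - \<theta> u\<^sub>2 (\<theta> u\<^sub>1 ys # xs) + \<theta> u\<^sub>1 (\<theta> u\<^sub>2 ys # xs)) \<and>
    (\<forall>us ys. length us = n \<longrightarrow> length ys = n - 1 \<longrightarrow>
      brG (\<omega> us # ys) + \<theta> (brV us) ys =
        (\<Sum>i<n. sG ((-1) ^ (n - Suc i)) (\<rho> (omit i us) (\<theta> (us ! i) ys)))) \<and>
    (\<forall>v us ys. length us = n \<longrightarrow> length ys = n - 2 \<longrightarrow> \<theta> v (\<omega> us # ys) = 0)"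
proof -
  interpret n_lie_algebra sG n brG by fact
  interpret V: n_lie_algebra sV n brV by fact
  interpret crossed_product n sG sV brG brV \<theta> \<rho> \<omega>
    using assms by unfold_locales
  show ?thesis
    unfolding n_lie_representation_def one_cocycle_def n_lie_derivation_def
    using rho_alternating_End rho_commutator rho_brV omega_alternating omega_cocycle
      theta_linear_first theta_derivation theta_exchange brG_omega_theta_brV theta_omega_eq_0
    by simp
qed

end
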